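(* Fix $d,k\in\mathbb{N}$ and $\alpha>0$. Let $\mu$ be a square-integrable probability measure on $\mathbb{R}^d$, i.e. $\int_{\mathbb{R}^d}\|x\|_2^2\,d\mu(x)<\infty$. Let $x_1,x_2,\dots$ be i.i.d. samples from $\mu$, let $X_N=\{x_i\}_{i\in[N]}$ be the first $N$ samples, and let $\mu_N=\frac1N\sum_{i\in[N]}\delta_{x_i}$. For each $N$, let $A_N\in\{\mathbb{R}^d\}^k$ be a solution of $$\min_{A\in\{\mathbb{R}^d\}^k}F_{\mu_N,\alpha}(A)\quad\text{subject to}\quad A\subset\mathrm{co}(X_N).$$ Suppose that, almost surely, for any $r>0$ there exists some $N(r)\in\mathbb{N}$ such that $B(r)\subset\mathrm{co}(X_{N(r)})$. Then, almost surely, $(A_N)_N$ has a subsequence $(A_{N_m})_m$ that converges in the metric $d_{2,\infty}$ to a limit lying in the solution set of $$\min_{A\in\{\mathbb{R}^d\}^k}F_{\mu,\alpha}(A)\quad\text{subject to}\quad A\subset\mathrm{co}(\mathrm{supp}(\mu)).\qquad(\ast)$$ If problem $(\ast)$ has a unique solution $A_\star$, then $A_N$ converges to $A_\star$ in $d_{2,\infty}$ almost surely.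
   Context: $[k]=\{1,\dots,k\}$. $\{\mathbb{R}^d\}^k$ denotes the set of unordered collections $A=\{a_\ell\}_{\ell\in[k]}$ of $k$ points of $\mathbb{R}^d$ (repetitions allowed), i.e. $(\mathbb{R}^d)^k$ modulo permutation of components. $\mathrm{co}(\cdot)$ denotes convex hull, $d(x,S)=\inf_{y\in S}\|x-y\|_2$, and $B(r)$ is the ball of radius $r$ centered at the origin. For a probability measure $\nu$ on $\mathbb{R}^d$, the variance-regularized objective is $$F_{\nu,\alpha}(A)=\left(\int_{\mathbb{R}^d}d^2(x,\mathrm{co}(A))\,d\nu(x)+\frac{\alpha}{k}\sum_{\ell\in[k]}\|a_\ell-\bar a\|_2^2\right)^{1/2},\qquad \bar a=\frac1k\sum_{\ell\in[k]}a_\ell.$$ The metric $d_{2,\infty}$ on $\{\mathbb{R}^d\}^k$ is $$d_{2,\infty}(\{a_\ell\}_{\ell\in[k]},\{b_\ell\}_{\ell\in[k]})=\min_{\sigma\in S[k]}\max_{\ell\in[k]}\|a_{\sigma(\ell)}-b_\ell\|_2,$$ where $S[k]$ is the set of permutations of $[k]$. "Almost surely" refers to the law of the i.i.d. sequence $(x_i)_{i\ge1}$ (the paper writes "$\mu$-a.s."). *)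

theory Defs
  imports "HOL-Probability.Probability" "HOL-Combinatorics.Combinatorics"
begin

text \<open>
  An unordered collection of \<open>k\<close> points, repetitions allowed, is a multiset of size \<open>k\<close>:
  the multisets of size \<open>k\<close> are exactly the \<open>k\<close>-tuples modulo permutation of their components.
\<close>

definition mset_mean :: "'a::euclidean_space multiset \<Rightarrow> 'a" where
  "mset_mean A = (1 / real (size A)) *\<^sub>R (\<Sum>a\<in>#A. a)"

text \<open>
  The integral is a Bochner integral, so it is only meaningful when the integrand is integrable;
  for a nonempty \<open>A\<close> this holds as soon as \<open>\<nu>\<close> has a finite second moment.
\<close>

definition var_objective :: "'a::euclidean_space measure \<Rightarrow> real \<Rightarrow> 'a multiset \<Rightarrow> real" where
  "var_objective \<nu> \<alpha> A =
     sqrt ((\<integral>x. (infdist x (convex hull (set_mset A)))\<^sup>2 \<partial>\<nu>)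
           + \<alpha> / real (size A) * (\<Sum>a\<in>#A. (norm (a - mset_mean A))\<^sup>2))"

definition solution_set ::
    "'a::euclidean_space measure \<Rightarrow> real \<Rightarrow> nat \<Rightarrow> 'a set \<Rightarrow> 'a multiset set" where
  "solution_set \<nu> \<alpha> k S =
     {A. is_arg_min (var_objective \<nu> \<alpha>) (\<lambda>B. size B = k \<and> set_mset B \<subseteq> S) A}"

definition measure_support :: "'a::topological_space measure \<Rightarrow> 'a set" where
  "measure_support \<mu> = {x. \<forall>U. open U \<longrightarrow> x \<in> U \<longrightarrow> emeasure \<mu> U > 0}"

definition empirical_measure :: "nat \<Rightarrow> (nat \<Rightarrow> 'a::topological_space) \<Rightarrow> 'a measure" where
  "empirical_measure N x = distr (uniform_count_measure {1..N}) borel x"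

lemma emeasure_empirical_measure:
  assumes "1 \<le> N" and "B \<in> sets borel"
  shows "emeasure (empirical_measure N x) B =
           (\<Sum>i\<in>{1..N}. emeasure (return borel (x i)) B) / of_nat N"
proof -
  have m: "x \<in> measurable (uniform_count_measure {1..N}) borel"
    by (simp add: measurable_def sets_uniform_count_measure space_uniform_count_measure)
  have "emeasure (empirical_measure N x) B = emeasure (uniform_count_measure {1..N}) (x -` B \<inter> {1..N})"
    using assms m by (simp add: empirical_measure_def emeasure_distr space_uniform_count_measure)
  also have "\<dots> = ennreal (real (card (x -` B \<inter> {1..N})) / real N)"
    by (subst emeasure_uniform_count_measure) auto
  also have "\<dots> = of_nat (card (x -` B \<inter> {1..N})) / of_nat N"
    using assms by (simp add: divide_ennreal[symmetric] ennreal_of_nat_eq_real_of_nat)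
  also have "of_nat (card (x -` B \<inter> {1..N})) = (\<Sum>i\<in>{1..N}. indicator B (x i) :: ennreal)"
    by (simp add: indicator_def sum.If_cases Int_def vimage_def conj_commute)
  finally show ?thesis
    using assms by simp
qed

text \<open>
  The metric is defined through arbitrary enumerations of the two collections; lemma
  \<open>dist_2_inf_mset\<close> shows that the value does not depend on the enumerations chosen.
\<close>

definition list_dist_2_inf :: "'a::euclidean_space list \<Rightarrow> 'a list \<Rightarrow> real" where
  "list_dist_2_inf as bs =
     Min ((\<lambda>\<sigma>. Max ((\<lambda>l. norm (as ! \<sigma> l - bs ! l)) ` {..<length bs}))
          ` {\<sigma>. \<sigma> permutes {..<length bs}})"

definition dist_2_inf :: "'a::euclidean_space multiset \<Rightarrow> 'a multiset \<Rightarrow> real" where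
  "dist_2_inf A B = list_dist_2_inf (SOME as. mset as = A) (SOME bs. mset bs = B)"

lemma list_dist_2_inf_permute_list:
  assumes len: "length as = length bs"
    and p: "p permutes {..<length as}" and q: "q permutes {..<length bs}"
  shows "list_dist_2_inf (permute_list p as) (permute_list q bs) = list_dist_2_inf as bs"
proof -
  let ?I = "{..<length bs}"
  let ?P = "{\<sigma>. \<sigma> permutes ?I}"
  define c where "c \<sigma> = Max ((\<lambda>l. norm (as ! \<sigma> l - bs ! l)) ` ?I)" for \<sigma> :: "nat \<Rightarrow> nat"
  define h where "h \<sigma> = p \<circ> \<sigma> \<circ> inv q" for \<sigma> :: "nat \<Rightarrow> nat"
  have p': "p permutes ?I" using p len by simp
  have 1: "Max ((\<lambda>l. norm (permute_list p as ! \<sigma> l - permute_list q bs ! l)) ` ?I) = c (h \<sigma>)"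
    if \<sigma>: "\<sigma> permutes ?I" for \<sigma>
  proof -
    have "(\<lambda>l. norm (permute_list p as ! \<sigma> l - permute_list q bs ! l)) ` ?I
        = (\<lambda>l. norm (as ! h \<sigma> (q l) - bs ! q l)) ` ?I"
    proof (rule image_cong[OF refl])
      fix l assume l: "l \<in> ?I"
      then have "\<sigma> l \<in> ?I" using \<sigma> by (simp only: permutes_in_image)
      then show "norm (permute_list p as ! \<sigma> l - permute_list q bs ! l)
               = norm (as ! h \<sigma> (q l) - bs ! q l)"
        using l p q len by (simp add: permute_list_nth h_def permutes_inverses)
    qed
    also have "\<dots> = (\<lambda>l. norm (as ! h \<sigma> l - bs ! l)) ` (q ` ?I)"
      by (simp only: image_image)
    also have "q ` ?I = ?I" using q by (rule permutes_image)
    finally show ?thesis by (simp add: c_def)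
  qed
  have h_P: "h ` ?P = ?P"
  proof (rule antisym; rule subsetI)
    fix \<tau> assume "\<tau> \<in> h ` ?P"
    then show "\<tau> \<in> ?P"
      using p' q by (auto simp: h_def intro!: permutes_compose permutes_inv)
  next
    fix \<tau> assume t: "\<tau> \<in> ?P"
    have "inv p \<circ> \<tau> \<circ> q \<in> ?P"
      using t p' q by (auto intro!: permutes_compose permutes_inv)
    moreover have "h (inv p \<circ> \<tau> \<circ> q) = \<tau>"
      using p' q by (auto simp: h_def fun_eq_iff permutes_inverses)
    ultimately show "\<tau> \<in> h ` ?P" by (metis imageI)
  qed
  have "list_dist_2_inf (permute_list p as) (permute_list q bs) = Min ((\<lambda>\<sigma>. c (h \<sigma>)) ` ?P)"
    unfolding list_dist_2_inf_def length_permute_list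
    by (intro arg_cong[where f = Min] image_cong[OF refl]) (simp add: 1)
  also have "(\<lambda>\<sigma>. c (h \<sigma>)) ` ?P = c ` (h ` ?P)"
    by (simp only: image_image)
  also have "\<dots> = c ` ?P" by (simp only: h_P)
  finally show ?thesis by (simp add: list_dist_2_inf_def c_def)
qed

lemma dist_2_inf_mset:
  assumes "length as = length bs"
  shows "dist_2_inf (mset as) (mset bs) = list_dist_2_inf as bs"
proof -
  have "mset (SOME xs. mset xs = mset as) = mset as"
    by (rule someI) (rule refl)
  then obtain p where p: "p permutes {..<length as}"
      "permute_list p as = (SOME xs. mset xs = mset as)"
    by (rule mset_eq_permutation)
  have "mset (SOME xs. mset xs = mset bs) = mset bs"
    by (rule someI) (rule refl)
  then obtain q where q: "q permutes {..<length bs}"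
      "permute_list q bs = (SOME xs. mset xs = mset bs)"
    by (rule mset_eq_permutation)
  show ?thesis
    using list_dist_2_inf_permute_list[OF assms p(1) q(1)] p(2) q(2)
    by (simp add: dist_2_inf_def)
qed

end

theory Submission
  imports Defs "HOL-Library.Discrete_Functions"
begin

text \<open>
  Subtracting the constant \<open>\<integral>\<parallel>y\<parallel>\<^sup>2\<close> from the squared objective replaces the integrand by
  \<open>d\<^sup>2(y, co A) - \<parallel>y\<parallel>\<^sup>2\<close>, which grows only linearly in \<open>y\<close> and is therefore square integrable. So
  the strong law for square-integrable variables suffices, and it is needed only for a countable
  dense family of tuples, since the integrand is Lipschitz in the tuple. Comparison with the
  tuple \<open>(0, \<dots>, 0)\<close> bounds the empirical minimizers in terms of the empirical mean of \<open>\<parallel>y\<parallel>\<close>, so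
  they have convergent subsequences. Every fixed competitor is eventually feasible, so each
  subsequential limit is an unconstrained minimizer for \<open>\<mu>\<close>, and \<open>co(supp \<mu>)\<close> is the whole space.
\<close>

subsection \<open>Strong law of large numbers for square-integrable variables\<close>

text \<open>The cross terms vanish: each new variable is independent of the sum of the earlier ones,
  and its mean is zero.\<close>

lemma (in prob_space) expectation_square_sum_centered:
  fixes Z :: "'i \<Rightarrow> 'a \<Rightarrow> real"
  assumes "finite I" and "indep_vars (\<lambda>_. borel) Z I"
    and "\<And>i. i \<in> I \<Longrightarrow> integrable M (\<lambda>\<omega>. (Z i \<omega>)\<^sup>2)"
    and "\<And>i. i \<in> I \<Longrightarrow> expectation (Z i) = 0"
  shows "integrable M (\<lambda>\<omega>. (\<Sum>i\<in>I. Z i \<omega>)\<^sup>2) \<and>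
    expectation (\<lambda>\<omega>. (\<Sum>i\<in>I. Z i \<omega>)\<^sup>2) = (\<Sum>i\<in>I. expectation (\<lambda>\<omega>. (Z i \<omega>)\<^sup>2))"
  using assms
proof (induction I rule: finite_induct)
  case empty
  then show ?case by simp
next
  case (insert i I)
  have meas: "\<And>j. j \<in> insert i I \<Longrightarrow> Z j \<in> borel_measurable M"
    using insert.prems(1) by (auto simp: indep_vars_def)
  have int: "\<And>j. j \<in> insert i I \<Longrightarrow> integrable M (Z j)"
    using insert.prems(2) meas by (blast intro: square_integrable_imp_integrable)
  have IH: "integrable M (\<lambda>\<omega>. (\<Sum>j\<in>I. Z j \<omega>)\<^sup>2)"
    "expectation (\<lambda>\<omega>. (\<Sum>j\<in>I. Z j \<omega>)\<^sup>2) = (\<Sum>j\<in>I. expectation (\<lambda>\<omega>. (Z j \<omega>)\<^sup>2))"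
    using insert.IH insert.prems indep_vars_subset[OF insert.prems(1), of I] by auto
  have ind: "indep_var borel (Z i) borel (\<lambda>\<omega>. \<Sum>j\<in>I. Z j \<omega>)"
    using insert by (intro indep_vars_sum) auto
  have intI: "integrable M (\<lambda>\<omega>. \<Sum>j\<in>I. Z j \<omega>)" using int by auto
  have c: "integrable M (\<lambda>\<omega>. Z i \<omega> * (\<Sum>j\<in>I. Z j \<omega>))"
    using indep_var_integrable[OF ind] int intI by auto
  have c0: "expectation (\<lambda>\<omega>. Z i \<omega> * (\<Sum>j\<in>I. Z j \<omega>)) = 0"
    using indep_var_lebesgue_integral[OF ind] int intI insert.prems(3) by auto
  have eq: "(\<lambda>\<omega>. (\<Sum>j\<in>insert i I. Z j \<omega>)\<^sup>2)
      = (\<lambda>\<omega>. ((Z i \<omega>)\<^sup>2 + 2 * (Z i \<omega> * (\<Sum>j\<in>I. Z j \<omega>))) + (\<Sum>j\<in>I. Z j \<omega>)\<^sup>2)"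
    using insert.hyps by (auto simp: power2_sum algebra_simps)
  have i2: "integrable M (\<lambda>\<omega>. (Z i \<omega>)\<^sup>2)" using insert.prems(2) by auto
  show ?case
    unfolding eq using insert.hyps IH c c0 i2 by simp
qed

text \<open>With nonnegative terms the partial sums are monotone, so for n^2 \<le> N < (n+1)^2 the
  sum at N lies between the sums at the two squares. The ratio of consecutive squares tends to 1, so
  the averages are squeezed.\<close>

lemma averages_tendsto_of_square_subsequence:
  fixes Y :: "nat \<Rightarrow> real"
  assumes nonneg: "\<And>i. 1 \<le> i \<Longrightarrow> 0 \<le> Y i"
    and sub: "(\<lambda>n. (\<Sum>i=1..n\<^sup>2. Y i) / real (n\<^sup>2)) \<longlonglongrightarrow> m"
  shows "(\<lambda>N. (\<Sum>i=1..N. Y i) / real N) \<longlonglongrightarrow> m"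
proof -
  define S where "S N = (\<Sum>i=1..N. Y i)" for N
  have S_mono: "S a \<le> S b" if "a \<le> b" for a b
    unfolding S_def using that nonneg by (intro sum_mono2) auto
  have S_nonneg: "0 \<le> S a" for a
    unfolding S_def using nonneg by (intro sum_nonneg) auto
  have sub': "(\<lambda>n. S (n\<^sup>2) / real (n\<^sup>2)) \<longlonglongrightarrow> m"
    using sub by (simp only: S_def)
  have r1: "(\<lambda>n. real (n\<^sup>2) / real ((Suc n)\<^sup>2)) \<longlonglongrightarrow> 1"
  proof -
    have "(\<lambda>n. (real n / real (Suc n))\<^sup>2) \<longlonglongrightarrow> 1\<^sup>2"
      by (intro tendsto_intros LIMSEQ_n_over_Suc_n)
    then show ?thesis by (simp add: power_divide)
  qed
  have r2: "(\<lambda>n. real ((Suc n)\<^sup>2) / real (n\<^sup>2)) \<longlonglongrightarrow> 1"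
    using tendsto_inverse[OF r1] by (simp add: inverse_eq_divide)
  \<comment> \<open>This turns limits in n into limits in N, with n the integer square root of
    N.\<close>
  have root: "filterlim floor_sqrt at_top at_top"
    unfolding filterlim_at_top
    by (auto simp: le_floor_sqrt_iff eventually_at_top_linorder)
  \<comment> \<open>For n \<ge> 1 the factors in \<open>lo\<close> and \<open>hi\<close> cancel to
    \<open>S (n\<^sup>2) / (Suc n)\<^sup>2\<close> and
    \<open>S ((Suc n)\<^sup>2) / n\<^sup>2\<close>, the two sides of the sandwich.\<close>
  have lo: "(\<lambda>n. S (n\<^sup>2) / real (n\<^sup>2) * (real (n\<^sup>2) / real ((Suc n)\<^sup>2))) \<longlonglongrightarrow> m"
    using tendsto_mult[OF sub' r1] by simp
  have hi: "(\<lambda>n. S ((Suc n)\<^sup>2) / real ((Suc n)\<^sup>2) * (real ((Suc n)\<^sup>2) / real (n\<^sup>2))) \<longlonglongrightarrow> m"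
    using tendsto_mult[OF LIMSEQ_Suc[OF sub'] r2] by simp
  have "(\<lambda>N. S N / real N) \<longlonglongrightarrow> m"
  proof (rule tendsto_sandwich[OF _ _ filterlim_compose[OF lo root] filterlim_compose[OF hi root]])
    have *: "S ((floor_sqrt N)\<^sup>2) / real ((Suc (floor_sqrt N))\<^sup>2) \<le> S N / real N \<and>
        S N / real N \<le> S ((Suc (floor_sqrt N))\<^sup>2) / real ((floor_sqrt N)\<^sup>2)" if "1 \<le> N" for N
    proof -
      let ?n = "floor_sqrt N"
      have a: "?n\<^sup>2 \<le> N" and b: "N < (Suc ?n)\<^sup>2"
        using Suc_floor_sqrt_power2_gt by auto
      have n: "1 \<le> ?n" using that by (simp add: le_floor_sqrt_iff)
      have a': "real (?n\<^sup>2) \<le> real N" and b': "real N \<le> real ((Suc ?n)\<^sup>2)"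
        using a b by (auto simp only: of_nat_le_iff)
      show ?thesis
        using that n S_mono[OF a] S_mono[OF less_imp_le[OF b]] S_nonneg a' b'
        by (intro conjI frac_le) auto
    qed
    show "\<forall>\<^sub>F N in sequentially. S ((floor_sqrt N)\<^sup>2) / real ((floor_sqrt N)\<^sup>2) *
            (real ((floor_sqrt N)\<^sup>2) / real ((Suc (floor_sqrt N))\<^sup>2)) \<le> S N / real N"
      using eventually_ge_at_top[of 1]
    proof eventually_elim
      case (elim N)
      then have "real ((floor_sqrt N)\<^sup>2) \<noteq> 0" by simp
      then show ?case using *[OF elim] by simp
    qed
    show "\<forall>\<^sub>F N in sequentially. S N / real N \<le> S ((Suc (floor_sqrt N))\<^sup>2) / real ((Suc (floor_sqrt N))\<^sup>2) *
            (real ((Suc (floor_sqrt N))\<^sup>2) / real ((floor_sqrt N)\<^sup>2))"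
      using eventually_ge_at_top[of 1]
    proof eventually_elim
      case (elim N)
      have "real ((Suc (floor_sqrt N))\<^sup>2) \<noteq> 0" by (simp only: of_nat_eq_0_iff) simp
      then show ?case using *[OF elim] by simp
    qed
  qed
  then show ?thesis by (simp only: S_def)
qed

text \<open>Along the squares the variances of the averages are summable, so the expected sum of the
  squared deviations is finite and the deviations tend to zero almost surely.\<close>

lemma (in prob_space) strong_law_nonneg:
  fixes X :: "nat \<Rightarrow> 'a \<Rightarrow> real"
  assumes ind: "indep_vars (\<lambda>_. borel) X {1..}"
    and sq: "\<And>i. 1 \<le> i \<Longrightarrow> integrable M (\<lambda>\<omega>. (X i \<omega>)\<^sup>2)"
    and mean: "\<And>i. 1 \<le> i \<Longrightarrow> expectation (X i) = m"
    and var: "\<And>i. 1 \<le> i \<Longrightarrow> variance (X i) = v"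
    and nonneg: "\<And>i \<omega>. 1 \<le> i \<Longrightarrow> 0 \<le> X i \<omega>"
  shows "AE \<omega> in M. (\<lambda>N. (\<Sum>i=1..N. X i \<omega>) / real N) \<longlonglongrightarrow> m"
proof -
  have meas: "\<And>i. 1 \<le> i \<Longrightarrow> X i \<in> borel_measurable M"
    using ind by (auto simp: indep_vars_def)
  have int: "\<And>i. 1 \<le> i \<Longrightarrow> integrable M (X i)"
    using sq meas by (blast intro: square_integrable_imp_integrable)
  define Z where "Z i \<omega> = X i \<omega> - m" for i \<omega>
  have indZ: "indep_vars (\<lambda>_. borel) Z {1..}"
    unfolding Z_def by (rule indep_vars_compose2[OF ind, of "\<lambda>_ t. t - m"]) auto
  have sqZ: "integrable M (\<lambda>\<omega>. (Z i \<omega>)\<^sup>2)" if "1 \<le> i" for i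
    unfolding Z_def power2_diff using sq[OF that] int[OF that] by simp
  have meanZ: "expectation (Z i) = 0" if "1 \<le> i" for i
    unfolding Z_def using int[OF that] mean[OF that] by (simp add: prob_space)
  have varZ: "expectation (\<lambda>\<omega>. (Z i \<omega>)\<^sup>2) = v" if "1 \<le> i" for i
    unfolding Z_def using var[OF that] mean[OF that] by simp
  define T where "T n \<omega> = (\<Sum>i=1..n\<^sup>2. X i \<omega>) / real (n\<^sup>2) - m" for n \<omega>
  have T_eq: "T n \<omega> = (\<Sum>i=1..n\<^sup>2. Z i \<omega>) / real (n\<^sup>2)" if "1 \<le> n" for n \<omega>
    using that by (simp add: T_def Z_def sum_subtractf field_simps)
  have v0: "0 \<le> v" using var[of 1] variance_positive[of "X 1"] by auto
  have T_int: "integrable M (\<lambda>\<omega>. (T n \<omega>)\<^sup>2)"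
    and T_exp: "expectation (\<lambda>\<omega>. (T n \<omega>)\<^sup>2) = v * (1 / real n ^ 2)" if n: "1 \<le> n" for n
  proof -
    have *: "integrable M (\<lambda>\<omega>. (\<Sum>i=1..n\<^sup>2. Z i \<omega>)\<^sup>2) \<and>
      expectation (\<lambda>\<omega>. (\<Sum>i=1..n\<^sup>2. Z i \<omega>)\<^sup>2) = (\<Sum>i=1..n\<^sup>2. expectation (\<lambda>\<omega>. (Z i \<omega>)\<^sup>2))"
      by (rule expectation_square_sum_centered)
        (auto intro: indep_vars_subset[OF indZ] sqZ meanZ)
    have eq: "(\<lambda>\<omega>. (T n \<omega>)\<^sup>2) = (\<lambda>\<omega>. (\<Sum>i=1..n\<^sup>2. Z i \<omega>)\<^sup>2 / (real (n\<^sup>2))\<^sup>2)"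
      using T_eq[OF n] by (simp add: power_divide)
    show "integrable M (\<lambda>\<omega>. (T n \<omega>)\<^sup>2)" unfolding eq using * by simp
    show "expectation (\<lambda>\<omega>. (T n \<omega>)\<^sup>2) = v * (1 / real n ^ 2)"
      unfolding eq using * varZ n by (simp add: power2_eq_square field_simps)
  qed
  \<comment> \<open>The index becomes \<open>Suc n\<close> because at 0 the average is 0/0 = 0, so
    that \<open>T 0\<close> is the constant -m and lies outside \<open>T_exp\<close>.\<close>
  have measT: "(\<lambda>\<omega>. (T (Suc n) \<omega>)\<^sup>2) \<in> borel_measurable M" for n
    using T_int[of "Suc n"] by auto
  have "summable (\<lambda>n. v * (1 / real n ^ 2))"
    using inverse_power_summable[of 2, where 'a=real]
    by (intro summable_mult) (simp add: inverse_eq_divide)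
  then have summ: "summable (\<lambda>n. v * (1 / real (Suc n) ^ 2))"
    by (subst summable_Suc_iff)
  have "(\<integral>\<^sup>+\<omega>. (\<Sum>n. ennreal ((T (Suc n) \<omega>)\<^sup>2)) \<partial>M) = (\<Sum>n. \<integral>\<^sup>+\<omega>. ennreal ((T (Suc n) \<omega>)\<^sup>2) \<partial>M)"
    using measT by (intro nn_integral_suminf) auto
  also have "\<dots> = (\<Sum>n. ennreal (v * (1 / real (Suc n) ^ 2)))"
  proof (intro suminf_cong)
    fix n
    show "(\<integral>\<^sup>+\<omega>. ennreal ((T (Suc n) \<omega>)\<^sup>2) \<partial>M) = ennreal (v * (1 / real (Suc n) ^ 2))"
      using nn_integral_eq_integral[OF T_int[of "Suc n"]] T_exp[of "Suc n"] by simp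
  qed
  also have "\<dots> \<noteq> \<infinity>"
    using summ v0 by (simp add: suminf_ennreal2 del: of_nat_Suc)
  finally have "AE \<omega> in M. (\<Sum>n. ennreal ((T (Suc n) \<omega>)\<^sup>2)) \<noteq> \<infinity>"
    using measT by (intro nn_integral_PInf_AE) auto
  then show ?thesis
  proof eventually_elim
    case (elim \<omega>)
    then have "summable (\<lambda>n. (T (Suc n) \<omega>)\<^sup>2)"
      by (intro summable_suminf_not_top) auto
    then have "(\<lambda>n. (T (Suc n) \<omega>)\<^sup>2) \<longlonglongrightarrow> 0" by (rule summable_LIMSEQ_zero)
    then have "(\<lambda>n. sqrt ((T (Suc n) \<omega>)\<^sup>2)) \<longlonglongrightarrow> sqrt 0" by (intro tendsto_intros)
    then have "(\<lambda>n. T (Suc n) \<omega>) \<longlonglongrightarrow> 0"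
      by (simp add: tendsto_rabs_zero_iff)
    then have "(\<lambda>n. T n \<omega>) \<longlonglongrightarrow> 0" by (rule LIMSEQ_imp_Suc)
    then have "(\<lambda>n. T n \<omega> + m) \<longlonglongrightarrow> 0 + m" by (intro tendsto_intros)
    then have "(\<lambda>n. (\<Sum>i=1..n\<^sup>2. X i \<omega>) / real (n\<^sup>2)) \<longlonglongrightarrow> m" by (simp add: T_def)
    then show ?case
      using nonneg by (intro averages_tendsto_of_square_subsequence) auto
  qed
qed

text \<open>The sandwich along squares works for nonnegative variables only, so f is split into its
  positive and negative parts. The common law \<mu> supplies one mean and one variance for all
  indices.\<close>

lemma (in prob_space) strong_law_iid:
  fixes x :: "nat \<Rightarrow> 'a \<Rightarrow> 'b::topological_space" and f :: "'b \<Rightarrow> real"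
  assumes ind: "indep_vars (\<lambda>_. borel) x {1..}"
    and dist: "\<And>i. 1 \<le> i \<Longrightarrow> distr M borel (x i) = \<mu>"
    and f: "f \<in> borel_measurable borel" and sq: "integrable \<mu> (\<lambda>y. (f y)\<^sup>2)"
  shows "AE \<omega> in M. (\<lambda>N. (\<Sum>i=1..N. f (x i \<omega>)) / real N) \<longlonglongrightarrow> (\<integral>y. f y \<partial>\<mu>)"
proof -
  have xm[measurable]: "\<And>i. 1 \<le> i \<Longrightarrow> x i \<in> borel_measurable M"
    using ind by (auto simp: indep_vars_def)
  have \<mu>eq: "\<mu> = distr M borel (x 1)" using dist[of 1] by simp
  interpret \<mu>: prob_space \<mu> unfolding \<mu>eq by (rule prob_space_distr) auto
  have sets: "sets \<mu> = sets borel" unfolding \<mu>eq by simp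
  have nonneg_case: "AE \<omega> in M. (\<lambda>N. (\<Sum>i=1..N. g (x i \<omega>)) / real N) \<longlonglongrightarrow> (\<integral>y. g y \<partial>\<mu>)"
    if g: "g \<in> borel_measurable borel" and gs: "integrable \<mu> (\<lambda>y. (g y)\<^sup>2)" and g0: "\<And>y. 0 \<le> g y"
    for g :: "'b \<Rightarrow> real"
  proof (rule strong_law_nonneg[where v = "\<integral>y. (g y - (\<integral>y. g y \<partial>\<mu>))\<^sup>2 \<partial>\<mu>"])
    show "indep_vars (\<lambda>_. borel) (\<lambda>i \<omega>. g (x i \<omega>)) {1..}"
      by (rule indep_vars_compose2[OF ind]) (use g in auto)
    fix i :: nat assume i: "1 \<le> i"
    note d = dist[OF i, symmetric]
    show "integrable M (\<lambda>\<omega>. (g (x i \<omega>))\<^sup>2)"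
      using gs i g unfolding d by (subst (asm) integrable_distr_eq) auto
    show e: "expectation (\<lambda>\<omega>. g (x i \<omega>)) = (\<integral>y. g y \<partial>\<mu>)"
      using i g unfolding d by (subst integral_distr) auto
    have "(\<integral>y. (g y - c)\<^sup>2 \<partial>\<mu>) = expectation (\<lambda>\<omega>. (g (x i \<omega>) - c)\<^sup>2)" for c
      using i g unfolding d by (subst integral_distr) auto
    then show "variance (\<lambda>\<omega>. g (x i \<omega>)) = (\<integral>y. (g y - (\<integral>y. g y \<partial>\<mu>))\<^sup>2 \<partial>\<mu>)"
      using e by simp
  qed (use g0 in auto)
  have fm: "f \<in> borel_measurable \<mu>" using f sets by (simp cong: measurable_cong_sets)
  \<comment> \<open>The squares of both parts are dominated by the square of f.\<close>
  have "integrable \<mu> (\<lambda>y. (max 0 (f y))\<^sup>2)" "integrable \<mu> (\<lambda>y. (max 0 (- f y))\<^sup>2)"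
    using fm by (auto intro!: Bochner_Integration.integrable_bound[OF sq] simp: max_def)
  then have nonneg_parts: "AE \<omega> in M. (\<lambda>N. (\<Sum>i=1..N. max 0 (f (x i \<omega>))) / real N) \<longlonglongrightarrow> (\<integral>y. max 0 (f y) \<partial>\<mu>)"
    "AE \<omega> in M. (\<lambda>N. (\<Sum>i=1..N. max 0 (- f (x i \<omega>))) / real N) \<longlonglongrightarrow> (\<integral>y. max 0 (- f y) \<partial>\<mu>)"
    using nonneg_case[of "\<lambda>y. max 0 (f y)"] nonneg_case[of "\<lambda>y. max 0 (- f y)"] f by auto
  have split: "(\<integral>y. f y \<partial>\<mu>) = (\<integral>y. max 0 (f y) \<partial>\<mu>) - (\<integral>y. max 0 (- f y) \<partial>\<mu>)"
  proof -
    have "integrable \<mu> f" by (rule \<mu>.square_integrable_imp_integrable[OF fm sq])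
    then have "(\<integral>y. max 0 (f y) \<partial>\<mu>) - (\<integral>y. max 0 (- f y) \<partial>\<mu>) = (\<integral>y. max 0 (f y) - max 0 (- f y) \<partial>\<mu>)"
      by (intro Bochner_Integration.integral_diff[symmetric]) auto
    also have "(\<lambda>y. max 0 (f y) - max 0 (- f y)) = f" by (auto simp: max_def)
    finally show ?thesis by simp
  qed
  from nonneg_parts show ?thesis
  proof eventually_elim
    case (elim \<omega>)
    have *: "(\<Sum>i=1..N. f (x i \<omega>)) / real N =
      (\<Sum>i=1..N. max 0 (f (x i \<omega>))) / real N - (\<Sum>i=1..N. max 0 (- f (x i \<omega>))) / real N" for N
      by (simp flip: diff_divide_distrib sum_subtractf) (auto intro!: sum.cong arg_cong2[where f="(/)"] simp: max_def)
    show ?case unfolding * split by (intro tendsto_diff elim)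
  qed
qed

subsection \<open>Tuples of points and their convex hulls\<close>

text \<open>Tuples are functions on all naturals of which only the first k values matter. This type
  carries the product topology, which is second countable and so provides a countable dense set of
  tuples.\<close>

definition tuple_hull :: "nat \<Rightarrow> (nat \<Rightarrow> 'a::euclidean_space) \<Rightarrow> 'a set" where
  "tuple_hull k a = convex hull (a ` {..<k})"

definition tuple_mean :: "nat \<Rightarrow> (nat \<Rightarrow> 'a::euclidean_space) \<Rightarrow> 'a" where
  "tuple_mean k a = (1 / real k) *\<^sub>R (\<Sum>i<k. a i)"

definition tuple_spread :: "nat \<Rightarrow> (nat \<Rightarrow> 'a::euclidean_space) \<Rightarrow> real" where
  "tuple_spread k a = (\<Sum>i<k. (norm (a i - tuple_mean k a))\<^sup>2)"

definition tuple_mset :: "nat \<Rightarrow> (nat \<Rightarrow> 'a) \<Rightarrow> 'a multiset" where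
  "tuple_mset k a = mset (map a [0..<k])"

text \<open>The squared distance alone grows quadratically in y, and its square integrability would
  ask for a fourth moment.\<close>

definition sqdist_gap :: "nat \<Rightarrow> (nat \<Rightarrow> 'a::euclidean_space) \<Rightarrow> 'a \<Rightarrow> real" where
  "sqdist_gap k a y = (infdist y (tuple_hull k a))\<^sup>2 - (norm y)\<^sup>2"

lemma tuple_hull_nonempty: "1 \<le> k \<Longrightarrow> tuple_hull k a \<noteq> {}"
  by (auto simp: tuple_hull_def lessThan_empty_iff)

lemma compact_tuple_hull: "compact (tuple_hull k a)"
  unfolding tuple_hull_def by (intro compact_convex_hull finite_imp_compact) auto

lemma infdist_tuple_hull_attained:
  assumes "1 \<le> k"
  obtains p where "p \<in> tuple_hull k a" "infdist y (tuple_hull k a) = dist y p"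
  using infdist_attains_inf[OF compact_imp_closed[OF compact_tuple_hull] tuple_hull_nonempty[OF assms]]
  by metis

text \<open>The Minkowski sum of the hull of b with the closed \<epsilon>-ball is convex and
  contains every \<open>a i\<close>, hence the whole hull of a. The point of that hull nearest to y
  is therefore within \<epsilon> of the hull of b.\<close>

lemma infdist_tuple_hull_perturb:
  assumes k: "1 \<le> k" and \<epsilon>: "\<And>i. i < k \<Longrightarrow> norm (a i - b i) \<le> \<epsilon>"
  shows "infdist y (tuple_hull k b) \<le> infdist y (tuple_hull k a) + \<epsilon>"
proof -
  obtain p where p: "p \<in> tuple_hull k a" "infdist y (tuple_hull k a) = dist y p"
    using infdist_tuple_hull_attained[OF k] .
  have "tuple_hull k a \<subseteq> (\<Union>u\<in>tuple_hull k b. \<Union>v\<in>cball 0 \<epsilon>. {u + v})"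
    unfolding tuple_hull_def
  proof (rule hull_minimal)
    show "convex (\<Union>u\<in>convex hull (b ` {..<k}). \<Union>v\<in>cball 0 \<epsilon>. {u + v})"
      by (intro convex_sums convex_convex_hull convex_cball)
    show "a ` {..<k} \<subseteq> (\<Union>u\<in>convex hull (b ` {..<k}). \<Union>v\<in>cball 0 \<epsilon>. {u + v})"
    proof clarify
      fix i assume i: "i < k"
      have "b i \<in> convex hull (b ` {..<k})" using i by (simp add: hull_inc)
      moreover have "a i - b i \<in> cball 0 \<epsilon>" using \<epsilon>[OF i] by simp
      moreover have "a i = b i + (a i - b i)" by simp
      ultimately show "a i \<in> (\<Union>u\<in>convex hull (b ` {..<k}). \<Union>v\<in>cball 0 \<epsilon>. {u + v})" by blast
    qed
  qed
  then obtain u v where u: "u \<in> tuple_hull k b" and v: "norm v \<le> \<epsilon>" "p = u + v"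
    using p(1) by (fastforce simp: subset_iff)
  have "infdist y (tuple_hull k b) \<le> dist y u" using u by (rule infdist_le)
  also have "\<dots> \<le> dist y p + dist p u" by (rule dist_triangle)
  finally show ?thesis using v p by (simp add: dist_norm)
qed

lemma tuple_hull_zero: "1 \<le> k \<Longrightarrow> tuple_hull k (\<lambda>_. 0) = {0}"
  by (simp add: tuple_hull_def image_constant_conv lessThan_empty_iff)

lemma sqdist_gap_zero: "1 \<le> k \<Longrightarrow> sqdist_gap k (\<lambda>_. 0) y = 0"
  by (simp add: sqdist_gap_def tuple_hull_zero)

lemma tuple_spread_zero: "tuple_spread k (\<lambda>_. 0) = 0"
  by (simp add: tuple_spread_def tuple_mean_def)

text \<open>The squared norm of y cancels and the rest factors as (s - t)(s + t). The first factor
  is at most \<epsilon> by perturbation; perturbing from the zero tuple, whose hull is {0}, bounds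
  each distance by \<open>norm y + R\<close>.\<close>

lemma sqdist_gap_lipschitz:
  assumes k: "1 \<le> k" and \<epsilon>: "\<And>i. i < k \<Longrightarrow> norm (a i - b i) \<le> \<epsilon>"
    and R: "\<And>i. i < k \<Longrightarrow> norm (a i) \<le> R" "\<And>i. i < k \<Longrightarrow> norm (b i) \<le> R"
  shows "\<bar>sqdist_gap k a y - sqdist_gap k b y\<bar> \<le> 2 * \<epsilon> * (norm y + R)"
proof -
  define s where "s = infdist y (tuple_hull k a)"
  define t where "t = infdist y (tuple_hull k b)"
  have st: "\<bar>s - t\<bar> \<le> \<epsilon>"
    using infdist_tuple_hull_perturb[OF k, of a b \<epsilon> y] infdist_tuple_hull_perturb[OF k, of b a \<epsilon> y] \<epsilon>
    by (simp add: norm_minus_commute s_def t_def)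
  have "s \<le> norm y + R"
    using infdist_tuple_hull_perturb[OF k, of "\<lambda>_. 0" a R y] R by (simp add: s_def tuple_hull_zero[OF k])
  moreover have "t \<le> norm y + R"
    using infdist_tuple_hull_perturb[OF k, of "\<lambda>_. 0" b R y] R by (simp add: t_def tuple_hull_zero[OF k])
  ultimately have sum: "s + t \<le> 2 * (norm y + R)" by simp
  have nn: "0 \<le> s + t" by (simp add: s_def t_def infdist_nonneg)
  have "sqdist_gap k a y - sqdist_gap k b y = (s - t) * (s + t)"
    by (simp add: sqdist_gap_def s_def t_def algebra_simps power2_eq_square)
  then have "\<bar>sqdist_gap k a y - sqdist_gap k b y\<bar> = \<bar>s - t\<bar> * (s + t)"
    using nn by (simp add: abs_mult)
  also have "\<dots> \<le> \<epsilon> * (2 * (norm y + R))"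
    using st sum nn by (intro mult_mono) auto
  finally show ?thesis by (simp add: algebra_simps)
qed

lemma sqdist_gap_abs_le:
  assumes k: "1 \<le> k" and R: "\<And>i. i < k \<Longrightarrow> norm (a i) \<le> R"
  shows "\<bar>sqdist_gap k a y\<bar> \<le> 2 * R * (norm y + R)"
proof -
  have "0 \<le> R" using R[of 0] k norm_ge_zero[of "a 0"] by linarith
  then show ?thesis
    using sqdist_gap_lipschitz[OF k, of a "\<lambda>_. 0" R R y] R by (simp add: sqdist_gap_zero[OF k])
qed

lemma borel_measurable_sqdist_gap [measurable]: "sqdist_gap k a \<in> borel_measurable borel"
  unfolding sqdist_gap_def
  by (intro borel_measurable_continuous_onI continuous_intros)

text \<open>For the nearest point p the gap equals |p|^2 - 2<y,p>, and Cauchy-Schwarz with |p| \<le>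
  R bounds the inner product. All tuple points lie within D of the mean, so the hull lies within 2D
  of \<open>a j\<close>, which has norm R; hence |p| \<ge> R - 2D.\<close>

lemma sqdist_gap_lower_bound:
  assumes k: "1 \<le> k" and R: "\<And>i. i < k \<Longrightarrow> norm (a i) \<le> R"
    and j: "j < k" "norm (a j) = R"
    and D: "\<And>i. i < k \<Longrightarrow> norm (a i - tuple_mean k a) \<le> D"
  shows "(max 0 (R - 2 * D))\<^sup>2 - 2 * R * norm y \<le> sqdist_gap k a y"
proof -
  obtain p where p: "p \<in> tuple_hull k a" "infdist y (tuple_hull k a) = dist y p"
    using infdist_tuple_hull_attained[OF k] .
  have "tuple_hull k a \<subseteq> cball 0 R" unfolding tuple_hull_def
    by (rule hull_minimal) (use R in auto)
  then have pR: "norm p \<le> R" using p by auto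
  have "tuple_hull k a \<subseteq> cball (a j) (2 * D)" unfolding tuple_hull_def
  proof (rule hull_minimal)
    show "a ` {..<k} \<subseteq> cball (a j) (2 * D)"
    proof clarify
      fix i assume "i < k"
      then show "a i \<in> cball (a j) (2 * D)"
        using D[of i] D[OF j(1)] norm_triangle_ineq4[of "a j - tuple_mean k a" "a i - tuple_mean k a"]
        by (simp add: dist_norm)
    qed
  qed auto
  then have "norm (a j - p) \<le> 2 * D" using p by (auto simp: dist_norm)
  then have "R - 2 * D \<le> norm p" using norm_triangle_ineq2[of "a j" p] j by linarith
  \<comment> \<open>R - 2D may be negative, and squaring is monotone only from 0 upwards.\<close>
  then have low: "(max 0 (R - 2 * D))\<^sup>2 \<le> (norm p)\<^sup>2" by (intro power_mono) auto
  have "y \<bullet> p \<le> norm y * R"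
    using Cauchy_Schwarz_ineq2[of y p] mult_left_mono[OF pR, of "norm y"] by auto
  moreover have "(dist y p)\<^sup>2 = (norm y)\<^sup>2 - 2 * (y \<bullet> p) + (norm p)\<^sup>2"
    by (simp add: dist_norm power2_norm_eq_inner inner_diff inner_commute)
  ultimately have "(norm p)\<^sup>2 - 2 * R * norm y \<le> sqdist_gap k a y"
    using p(2) by (simp add: sqdist_gap_def algebra_simps)
  then show ?thesis using low by linarith
qed

lemma norm_deviation_le_sqrt_spread:
  assumes "i < k"
  shows "norm (a i - tuple_mean k a) \<le> sqrt (tuple_spread k a)"
proof (rule real_le_rsqrt)
  show "(norm (a i - tuple_mean k a))\<^sup>2 \<le> tuple_spread k a"
    unfolding tuple_spread_def using assms
    by (intro member_le_sum[where f = "\<lambda>i. (norm (a i - tuple_mean k a))\<^sup>2"]) auto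
qed

lemma tendsto_tuple_spread:
  assumes "\<And>i. i < k \<Longrightarrow> ((\<lambda>m. a m i) \<longlongrightarrow> b i) F"
  shows "((\<lambda>m. tuple_spread k (a m)) \<longlongrightarrow> tuple_spread k b) F"
  unfolding tuple_spread_def tuple_mean_def using assms by (intro tendsto_intros) auto

section \<open>Multisets enumerated by tuples, and the metric between them\<close>

lemma size_tuple_mset [simp]: "size (tuple_mset k a) = k"
  by (simp add: tuple_mset_def)

lemma set_tuple_mset [simp]: "set_mset (tuple_mset k a) = a ` {..<k}"
  by (auto simp: tuple_mset_def)

lemma sum_tuple_mset: "(\<Sum>x\<in>#tuple_mset k a. f x) = (\<Sum>i<k. f (a i))"
  by (simp add: tuple_mset_def image_mset.compositionality comp_def flip: mset_map)
    (simp only: sum_mset_sum_list interv_sum_list_conv_sum_set_nat map_map comp_def set_upt atLeast0LessThan)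

lemma multiset_tuple_mset:
  assumes "size A = k"
  obtains a where "A = tuple_mset k a"
proof -
  obtain xs where xs: "mset xs = A" using ex_mset by blast
  have "tuple_mset (length xs) ((!) xs) = mset xs"
    unfolding tuple_mset_def map_nth ..
  then have "A = tuple_mset k ((!) xs)" using xs assms by auto
  then show ?thesis by (rule that)
qed

text \<open>The identity is one of the permutations in the minimum, and a maximum of nonnegative
  terms is at most their sum. Coordinatewise convergence of tuples thus gives convergence of the
  collections.\<close>

lemma dist_2_inf_tuple_mset_bounds:
  assumes k: "1 \<le> k"
  shows "0 \<le> dist_2_inf (tuple_mset k a) (tuple_mset k b)"
    and "dist_2_inf (tuple_mset k a) (tuple_mset k b) \<le> (\<Sum>i<k. norm (a i - b i))"
proof -
  let ?as = "map a [0..<k]" and ?bs = "map b [0..<k]"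
  let ?m = "\<lambda>\<sigma>. Max ((\<lambda>l. norm (?as ! \<sigma> l - ?bs ! l)) ` {..<k})"
  have eq: "dist_2_inf (tuple_mset k a) (tuple_mset k b) = Min (?m ` {\<sigma>. \<sigma> permutes {..<k}})"
    unfolding tuple_mset_def by (subst dist_2_inf_mset) (simp_all add: list_dist_2_inf_def)
  have fin: "finite (?m ` {\<sigma>. \<sigma> permutes {..<k}})"
    by (intro finite_imageI finite_permutations) simp
  have id: "id \<in> {\<sigma>. \<sigma> permutes {..<k}}" by (simp add: permutes_id)
  have "0 \<le> ?m \<sigma>" for \<sigma>
    using k by (subst Max_ge_iff) (auto simp: lessThan_empty_iff intro!: exI[of _ 0])
  then show "0 \<le> dist_2_inf (tuple_mset k a) (tuple_mset k b)"
    unfolding eq using fin id by (subst Min_ge_iff) (use id in blast)+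
  have "Min (?m ` {\<sigma>. \<sigma> permutes {..<k}}) \<le> ?m id"
    by (rule Min_le[OF fin]) (rule imageI[OF id])
  also have "\<dots> \<le> (\<Sum>i<k. norm (a i - b i))"
    using k by (subst Max_le_iff)
      (auto simp: lessThan_empty_iff intro!: member_le_sum[where f = "\<lambda>i. norm (a i - b i)"])
  finally show "dist_2_inf (tuple_mset k a) (tuple_mset k b) \<le> (\<Sum>i<k. norm (a i - b i))"
    unfolding eq .
qed

lemma tendsto_dist_2_inf_tuple_mset:
  assumes "1 \<le> k" and "\<And>i. i < k \<Longrightarrow> ((\<lambda>m. a m i) \<longlongrightarrow> b i) F"
  shows "((\<lambda>m. dist_2_inf (tuple_mset k (a m)) (tuple_mset k b)) \<longlongrightarrow> 0) F"
proof (rule tendsto_sandwich[OF _ _ tendsto_const])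
  have "((\<lambda>m. \<Sum>i<k. norm (a m i - b i)) \<longlongrightarrow> (\<Sum>i<k. norm (b i - b i))) F"
    using assms(2) by (intro tendsto_intros) auto
  then show "((\<lambda>m. \<Sum>i<k. norm (a m i - b i)) \<longlongrightarrow> 0) F" by simp
qed (simp_all add: dist_2_inf_tuple_mset_bounds[OF assms(1)])

subsection \<open>Convergence of minimizers\<close>

text \<open>A common interface for \<mu> and the empirical measures, so that each estimate is proved
  once for both.\<close>

definition second_moment_prob :: "'a::euclidean_space measure \<Rightarrow> bool" where
  "second_moment_prob \<nu> \<longleftrightarrow>
     prob_space \<nu> \<and> sets \<nu> = sets borel \<and> integrable \<nu> (\<lambda>y. (norm y)\<^sup>2)"

text \<open>This is the squared objective minus the second moment of \<nu>. The subtracted constant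
  does not depend on the tuple, so minimizers are unchanged, and the zero tuple gets the value
  0.\<close>

definition gap_objective :: "'a::euclidean_space measure \<Rightarrow> real \<Rightarrow> nat \<Rightarrow> (nat \<Rightarrow> 'a) \<Rightarrow> real" where
  "gap_objective \<nu> \<alpha> k a = (\<integral>y. sqdist_gap k a y \<partial>\<nu>) + \<alpha> / real k * tuple_spread k a"

lemma integrable_norm_second_moment:
  assumes "second_moment_prob \<nu>"
  shows "integrable \<nu> norm"
proof -
  interpret prob_space \<nu> using assms by (simp add: second_moment_prob_def)
  have s: "sets \<nu> = sets borel" using assms by (simp add: second_moment_prob_def)
  show ?thesis
    by (rule square_integrable_imp_integrable)
      (use assms in \<open>simp_all add: second_moment_prob_def measurable_cong_sets[OF s refl]\<close>)
qed

text \<open>The gap is at most linear in \<open>norm y\<close>, so its square is dominated by a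
  quadratic polynomial in \<open>norm y\<close>.\<close>

lemma integrable_sqdist_gap_square:
  assumes \<nu>: "second_moment_prob \<nu>" and k: "1 \<le> k"
  shows "integrable \<nu> (\<lambda>y. (sqdist_gap k a y)\<^sup>2)"
proof -
  interpret prob_space \<nu> using \<nu> by (simp add: second_moment_prob_def)
  have s: "sets \<nu> = sets borel" using \<nu> by (simp add: second_moment_prob_def)
  define R where "R = (\<Sum>i<k. norm (a i))"
  have R: "norm (a i) \<le> R" if "i < k" for i
    unfolding R_def using that by (intro member_le_sum[where f = "\<lambda>i. norm (a i)"]) auto
  show ?thesis
  proof (rule Bochner_Integration.integrable_bound)
    show "integrable \<nu> (\<lambda>y. (2 * R * (norm y + R))\<^sup>2)"
      using \<nu> integrable_norm_second_moment[OF \<nu>]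
      by (simp add: power_mult_distrib power2_sum second_moment_prob_def)
    show "(\<lambda>y. (sqdist_gap k a y)\<^sup>2) \<in> borel_measurable \<nu>"
      by (simp add: measurable_cong_sets[OF s refl])
    show "AE y in \<nu>. norm ((sqdist_gap k a y)\<^sup>2) \<le> norm ((2 * R * (norm y + R))\<^sup>2)"
    proof (rule AE_I2)
      fix y
      have "\<bar>sqdist_gap k a y\<bar>\<^sup>2 \<le> (2 * R * (norm y + R))\<^sup>2"
        by (intro power_mono sqdist_gap_abs_le[OF k R]) auto
      then show "norm ((sqdist_gap k a y)\<^sup>2) \<le> norm ((2 * R * (norm y + R))\<^sup>2)" by simp
    qed
  qed
qed

lemma integrable_sqdist_gap:
  assumes \<nu>: "second_moment_prob \<nu>" and k: "1 \<le> k"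
  shows "integrable \<nu> (sqdist_gap k a)"
proof -
  interpret prob_space \<nu> using \<nu> by (simp add: second_moment_prob_def)
  have s: "sets \<nu> = sets borel" using \<nu> by (simp add: second_moment_prob_def)
  show ?thesis
    by (rule square_integrable_imp_integrable[OF _ integrable_sqdist_gap_square[OF \<nu> k]])
      (simp add: measurable_cong_sets[OF s refl])
qed

lemma var_objective_tuple_mset:
  assumes \<nu>: "second_moment_prob \<nu>" and k: "1 \<le> k"
  shows "var_objective \<nu> \<alpha> (tuple_mset k a) =
    sqrt (gap_objective \<nu> \<alpha> k a + (\<integral>y. (norm y)\<^sup>2 \<partial>\<nu>))"
proof -
  have "(\<integral>y. (infdist y (tuple_hull k a))\<^sup>2 \<partial>\<nu>) = (\<integral>y. sqdist_gap k a y + (norm y)\<^sup>2 \<partial>\<nu>)"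
    by (simp add: sqdist_gap_def)
  also have "\<dots> = (\<integral>y. sqdist_gap k a y \<partial>\<nu>) + (\<integral>y. (norm y)\<^sup>2 \<partial>\<nu>)"
    using \<nu> integrable_sqdist_gap[OF \<nu> k]
    by (intro Bochner_Integration.integral_add) (auto simp: second_moment_prob_def)
  finally have int: "(\<integral>y. (infdist y (tuple_hull k a))\<^sup>2 \<partial>\<nu>)
      = (\<integral>y. sqdist_gap k a y \<partial>\<nu>) + (\<integral>y. (norm y)\<^sup>2 \<partial>\<nu>)" .
  have mean: "mset_mean (tuple_mset k a) = tuple_mean k a"
    using sum_tuple_mset[of "\<lambda>x. x" k a] by (simp add: mset_mean_def tuple_mean_def)
  show ?thesis
    using int by (simp add: var_objective_def gap_objective_def tuple_hull_def tuple_spread_def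
        mean sum_tuple_mset algebra_simps)
qed

text \<open>\<open>sqrt\<close> is strictly increasing on the whole real line, negative arguments
  included, and the second moment cancels.\<close>

lemma var_objective_le_iff:
  assumes "second_moment_prob \<nu>" and "1 \<le> k"
  shows "var_objective \<nu> \<alpha> (tuple_mset k a) \<le> var_objective \<nu> \<alpha> (tuple_mset k b)
    \<longleftrightarrow> gap_objective \<nu> \<alpha> k a \<le> gap_objective \<nu> \<alpha> k b"
  by (simp add: var_objective_tuple_mset[OF assms])

lemma gap_objective_zero: "1 \<le> k \<Longrightarrow> gap_objective \<nu> \<alpha> k (\<lambda>_. 0) = 0"
  by (simp add: gap_objective_def sqdist_gap_zero tuple_spread_zero)

text \<open>The constant depends on \<nu> only through its first moment, so the estimate is uniform
  over measures with bounded first moments.\<close>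

lemma gap_integral_lipschitz:
  assumes \<nu>: "second_moment_prob \<nu>" and k: "1 \<le> k"
    and \<epsilon>: "\<And>i. i < k \<Longrightarrow> norm (a i - b i) \<le> \<epsilon>"
    and R: "\<And>i. i < k \<Longrightarrow> norm (a i) \<le> R" "\<And>i. i < k \<Longrightarrow> norm (b i) \<le> R"
  shows "\<bar>(\<integral>y. sqdist_gap k a y \<partial>\<nu>) - (\<integral>y. sqdist_gap k b y \<partial>\<nu>)\<bar> \<le> 2 * \<epsilon> * ((\<integral>y. norm y \<partial>\<nu>) + R)"
proof -
  interpret prob_space \<nu> using \<nu> by (simp add: second_moment_prob_def)
  note int = integrable_sqdist_gap[OF \<nu> k] integrable_norm_second_moment[OF \<nu>]
  have "\<bar>(\<integral>y. sqdist_gap k a y \<partial>\<nu>) - (\<integral>y. sqdist_gap k b y \<partial>\<nu>)\<bar> = \<bar>\<integral>y. sqdist_gap k a y - sqdist_gap k b y \<partial>\<nu>\<bar>"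
    using int by simp
  also have "\<dots> \<le> (\<integral>y. \<bar>sqdist_gap k a y - sqdist_gap k b y\<bar> \<partial>\<nu>)"
    by (rule integral_abs_bound)
  also have "\<dots> \<le> (\<integral>y. 2 * \<epsilon> * (norm y + R) \<partial>\<nu>)"
    using int by (intro integral_mono sqdist_gap_lipschitz[OF k \<epsilon> R]) auto
  also have "\<dots> = 2 * \<epsilon> * ((\<integral>y. norm y \<partial>\<nu>) + R)"
    using int by (simp add: prob_space)
  finally show ?thesis .
qed

text \<open>The square of the largest norm is controlled by the distance of the hull from the origin
  plus the spread, whereas a nonpositive objective bounds these only linearly in that norm.\<close>

lemma norm_le_of_gap_objective_nonpos:
  assumes \<nu>: "second_moment_prob \<nu>" and k: "1 \<le> k" and \<alpha>: "0 < \<alpha>"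
    and le: "gap_objective \<nu> \<alpha> k a \<le> 0" and i: "i < k"
  shows "norm (a i) \<le> 2 * (2 + 8 * real k / \<alpha>) * (\<integral>y. norm y \<partial>\<nu>)"
proof -
  interpret prob_space \<nu> using \<nu> by (simp add: second_moment_prob_def)
  note int = integrable_sqdist_gap[OF \<nu> k] integrable_norm_second_moment[OF \<nu>]
  define X where "X = (\<integral>y. norm y \<partial>\<nu>)"
  have X0: "0 \<le> X" unfolding X_def by simp
  \<comment> \<open>The maximum is attained at some j, which serves as the reference point in
    \<open>sqdist_gap_lower_bound\<close>.\<close>
  define R where "R = Max ((\<lambda>i. norm (a i)) ` {..<k})"
  have R: "\<And>i. i < k \<Longrightarrow> norm (a i) \<le> R" unfolding R_def by auto
  have "R \<in> (\<lambda>i. norm (a i)) ` {..<k}"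
    unfolding R_def using k by (intro Max_in) (auto simp: lessThan_empty_iff)
  then obtain j where j: "j < k" "norm (a j) = R" by auto
  have R0: "0 \<le> R" using j by auto
  define D where "D = sqrt (tuple_spread k a)"
  define q where "q = max 0 (R - 2 * D)"
  have sp: "tuple_spread k a = D\<^sup>2"
    by (simp add: D_def tuple_spread_def sum_nonneg)
  have "q\<^sup>2 - 2 * R * X = (\<integral>y. q\<^sup>2 - 2 * R * norm y \<partial>\<nu>)"
    using int by (simp add: prob_space X_def)
  also have "\<dots> \<le> (\<integral>y. sqdist_gap k a y \<partial>\<nu>)"
  proof (rule integral_mono)
    show "q\<^sup>2 - 2 * R * norm y \<le> sqdist_gap k a y" for y
      unfolding q_def D_def
      by (rule sqdist_gap_lower_bound[where a = a and j = j, OF k _ j]) (auto intro: R norm_deviation_le_sqrt_spread)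
  qed (use int in auto)
  finally have main: "q\<^sup>2 + \<alpha> / real k * D\<^sup>2 \<le> 2 * R * X"
    using le by (simp add: gap_objective_def sp)
  have "R \<le> q + 2 * D" by (simp add: q_def)
  then have "R\<^sup>2 \<le> (q + 2 * D)\<^sup>2" using R0 by (intro power_mono)
  \<comment> \<open>(q + 2D)^2 and (q - 2D)^2 add up to exactly the right-hand side.\<close>
  also have "\<dots> \<le> 2 * q\<^sup>2 + 8 * D\<^sup>2"
    using zero_le_power2[of "q - 2 * D"] by (simp add: power2_sum power2_diff)
  \<comment> \<open>The summand 2 of the factor produces the term in q and the summand 8k/\<alpha>
    the term in D; the remaining products are nonnegative.\<close>
  also have "\<dots> \<le> (2 + 8 * real k / \<alpha>) * (q\<^sup>2 + \<alpha> / real k * D\<^sup>2)"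
  proof -
    have "(2 + 8 * real k / \<alpha>) * (q\<^sup>2 + \<alpha> / real k * D\<^sup>2)
      = 2 * q\<^sup>2 + 8 * D\<^sup>2 + (8 * real k / \<alpha> * q\<^sup>2 + 2 * \<alpha> / real k * D\<^sup>2)"
      using \<alpha> k by (simp add: field_simps)
    moreover have "0 \<le> 8 * real k / \<alpha> * q\<^sup>2 + 2 * \<alpha> / real k * D\<^sup>2" using \<alpha> by simp
    ultimately show ?thesis by linarith
  qed
  also have "\<dots> \<le> (2 + 8 * real k / \<alpha>) * (2 * R * X)"
    using main \<alpha> by (intro mult_left_mono) auto
  finally have "R * R \<le> R * (2 * (2 + 8 * real k / \<alpha>) * X)"
    by (simp add: power2_eq_square mult_ac)
  then have "R \<le> 2 * (2 + 8 * real k / \<alpha>) * X"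
    using R0 X0 \<alpha> by (cases "R = 0") auto
  then show ?thesis using R[OF i] unfolding X_def by linarith
qed

text \<open>A three-term estimate: a is replaced by a nearby c from D both under
  \<open>\<nu> N\<close> and under \<mu>, at a cost uniform in N because the first moments
  converge.\<close>

lemma tendsto_gap_integral_of_dense:
  assumes k: "1 \<le> k" and \<mu>: "second_moment_prob \<mu>"
    and \<nu>: "\<And>N. 1 \<le> N \<Longrightarrow> second_moment_prob (\<nu> N)"
    and dense: "\<And>U. open U \<Longrightarrow> U \<noteq> {} \<Longrightarrow> \<exists>c\<in>D. c \<in> U"
    and norm_lim: "(\<lambda>N. \<integral>y. norm y \<partial>\<nu> N) \<longlonglongrightarrow> (\<integral>y. norm y \<partial>\<mu>)"
    and gap_lim: "\<And>c. c \<in> D \<Longrightarrow> (\<lambda>N. \<integral>y. sqdist_gap k c y \<partial>\<nu> N) \<longlonglongrightarrow> (\<integral>y. sqdist_gap k c y \<partial>\<mu>)"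
  shows "(\<lambda>N. \<integral>y. sqdist_gap k a y \<partial>\<nu> N) \<longlonglongrightarrow> (\<integral>y. sqdist_gap k a y \<partial>\<mu>)"
proof (rule LIMSEQ_I)
  fix r :: real assume r: "0 < r"
  define R where "R = (\<Sum>i<k. norm (a i)) + 1"
  have aR: "norm (a i) + 1 \<le> R" if "i < k" for i
    unfolding R_def using that by (simp add: member_le_sum[where f = "\<lambda>i. norm (a i)"])
  define L where "L = (\<integral>y. norm y \<partial>\<mu>) + 1 + R"
  have "0 \<le> (\<integral>y. norm y \<partial>\<mu>)" by simp
  moreover have "1 \<le> R" by (simp add: R_def sum_nonneg)
  ultimately have L0: "0 < L" unfolding L_def by linarith
  \<comment> \<open>The bound 1 keeps the entries of c within R, which exceeds each
    \<open>norm (a i)\<close> by at least 1; the other bound makes each Lipschitz error at most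
    r/3.\<close>
  define \<epsilon> where "\<epsilon> = min 1 (r / (6 * L))"
  have \<epsilon>0: "0 < \<epsilon>" and \<epsilon>1: "\<epsilon> \<le> 1" using r L0 by (auto simp: \<epsilon>_def)
  have "\<epsilon> \<le> r / (6 * L)" by (simp add: \<epsilon>_def)
  then have \<epsilon>L: "2 * \<epsilon> * L \<le> r / 3" using L0 by (simp add: field_simps)
  \<comment> \<open>This cylinder constrains finitely many coordinates only, so it is open in the
    product topology and meets D.\<close>
  have "open {f. \<forall>i\<in>{..<k}. f (id i) \<in> ball (a i) \<epsilon>}"
    by (rule product_topology_basis') auto
  moreover have "a \<in> {f. \<forall>i\<in>{..<k}. f (id i) \<in> ball (a i) \<epsilon>}" using \<epsilon>0 by simp
  ultimately obtain c where c: "c \<in> D" and "c \<in> {f. \<forall>i\<in>{..<k}. f (id i) \<in> ball (a i) \<epsilon>}"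
    using dense by blast
  then have ca: "norm (a i - c i) \<le> \<epsilon>" if "i < k" for i using that by (auto simp: dist_norm less_imp_le)
  have aR': "norm (a i) \<le> R" if "i < k" for i using aR[OF that] by simp
  have cR: "norm (c i) \<le> R" if "i < k" for i
    using ca[OF that] aR[OF that] \<epsilon>1 norm_triangle_ineq2[of "c i" "a i"]
    by (simp add: norm_minus_commute)
  have close: "\<bar>(\<integral>y. sqdist_gap k a y \<partial>\<rho>) - (\<integral>y. sqdist_gap k c y \<partial>\<rho>)\<bar> \<le> r / 3"
    if \<rho>: "second_moment_prob \<rho>" and le: "(\<integral>y. norm y \<partial>\<rho>) \<le> (\<integral>y. norm y \<partial>\<mu>) + 1" for \<rho>
  proof -
    have "\<bar>(\<integral>y. sqdist_gap k a y \<partial>\<rho>) - (\<integral>y. sqdist_gap k c y \<partial>\<rho>)\<bar>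
        \<le> 2 * \<epsilon> * ((\<integral>y. norm y \<partial>\<rho>) + R)"
      using gap_integral_lipschitz[OF \<rho> k ca aR' cR] .
    also have "\<dots> \<le> 2 * \<epsilon> * L" using le \<epsilon>0 by (intro mult_left_mono) (auto simp: L_def)
    finally show ?thesis using \<epsilon>L by linarith
  qed
  have "\<forall>\<^sub>F N in sequentially. dist (\<integral>y. norm y \<partial>\<nu> N) (\<integral>y. norm y \<partial>\<mu>) < 1"
    using norm_lim by (rule tendstoD) simp
  moreover have "\<forall>\<^sub>F N in sequentially.
      dist (\<integral>y. sqdist_gap k c y \<partial>\<nu> N) (\<integral>y. sqdist_gap k c y \<partial>\<mu>) < r / 3"
    using gap_lim[OF c] by (rule tendstoD) (use r in simp)
  moreover have "\<forall>\<^sub>F N::nat in sequentially. 1 \<le> N" by (rule eventually_ge_at_top)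
  ultimately have "\<forall>\<^sub>F N in sequentially.
      norm ((\<integral>y. sqdist_gap k a y \<partial>\<nu> N) - (\<integral>y. sqdist_gap k a y \<partial>\<mu>)) < r"
  proof eventually_elim
    case (elim N)
    have "(\<integral>y. norm y \<partial>\<nu> N) \<le> (\<integral>y. norm y \<partial>\<mu>) + 1"
      using elim(1) by (simp add: dist_real_def)
    then show ?case
      using close[OF \<nu>[OF elim(3)]] close[OF \<mu>] elim(2)
      unfolding dist_real_def real_norm_def by linarith
  qed
  then show "\<exists>no. \<forall>N\<ge>no. norm ((\<integral>y. sqdist_gap k a y \<partial>\<nu> N) - (\<integral>y. sqdist_gap k a y \<partial>\<mu>)) < r"
    by (simp add: eventually_sequentially)
qed

text \<open>Bolzano-Weierstrass is applied to one coordinate after another; coordinates that already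
  converge keep their limits under further refinement.\<close>

lemma bounded_tuples_convergent_subsequence:
  fixes a :: "nat \<Rightarrow> nat \<Rightarrow> 'a::euclidean_space"
  assumes R: "\<And>m i. i < k \<Longrightarrow> norm (a m i) \<le> R"
  obtains r b where "strict_mono (r :: nat \<Rightarrow> nat)"
    "\<And>i. i < k \<Longrightarrow> (\<lambda>m. a (r m) i) \<longlonglongrightarrow> b i" "\<And>i. i < k \<Longrightarrow> norm (b i) \<le> R"
proof -
  have *: "\<exists>r b. strict_mono (r :: nat \<Rightarrow> nat) \<and> (\<forall>i<n. (\<lambda>m. a (r m) i) \<longlonglongrightarrow> b i)"
    if "n \<le> k" for n
    using that
  proof (induction n)
    case 0
    have "strict_mono (id :: nat \<Rightarrow> nat)" by (simp add: strict_mono_def)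
    then show ?case by auto
  next
    case (Suc n)
    then obtain r b where r: "strict_mono (r :: nat \<Rightarrow> nat)"
      and b: "\<forall>i<n. (\<lambda>m. a (r m) i) \<longlonglongrightarrow> b i" by auto
    have "bounded (range (\<lambda>m. a (r m) n))"
      using R Suc.prems by (auto simp: bounded_iff intro!: exI[of _ R])
    then obtain l s where s: "strict_mono (s :: nat \<Rightarrow> nat)"
      and l: "((\<lambda>m. a (r m) n) \<circ> s) \<longlonglongrightarrow> l"
      using bounded_imp_convergent_subsequence by blast
    have "(\<lambda>m. a ((r \<circ> s) m) i) \<longlonglongrightarrow> (b(n := l)) i" if "i < Suc n" for i
    proof (cases "i = n")
      case True
      then show ?thesis using l by (simp add: comp_def)
    next
      case False
      then have "(\<lambda>m. a (r m) i) \<longlonglongrightarrow> b i" using b that by auto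
      from LIMSEQ_subseq_LIMSEQ[OF this s] False show ?thesis by (simp add: comp_def)
    qed
    then show ?case using strict_mono_o[OF r s] by blast
  qed
  obtain r b where r: "strict_mono (r :: nat \<Rightarrow> nat)"
    and b: "\<And>i. i < k \<Longrightarrow> (\<lambda>m. a (r m) i) \<longlonglongrightarrow> b i"
    using *[of k] by auto
  have "norm (b i) \<le> R" if "i < k" for i
    using R[OF that] by (intro Lim_bounded[OF tendsto_norm[OF b[OF that]]]) auto
  then show ?thesis using that r b by blast
qed

text \<open>Comparison with the zero tuple bounds the minimizers, compactness gives a limit b, and
  the inequality against each fixed competitor passes to the limit. Starting from an arbitrary
  subsequence s prepares for convergence of the whole sequence when the solution is unique.\<close>

lemma minimizers_subsequential_limit:
  fixes a :: "nat \<Rightarrow> nat \<Rightarrow> 'a::euclidean_space"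
  assumes k: "1 \<le> k" and \<alpha>: "0 < \<alpha>" and \<mu>: "second_moment_prob \<mu>"
    and \<nu>: "\<And>N. 1 \<le> N \<Longrightarrow> second_moment_prob (\<nu> N)"
    and norm_lim: "(\<lambda>N. \<integral>y. norm y \<partial>\<nu> N) \<longlonglongrightarrow> (\<integral>y. norm y \<partial>\<mu>)"
    and gap_lim: "\<And>c. (\<lambda>N. \<integral>y. sqdist_gap k c y \<partial>\<nu> N) \<longlonglongrightarrow> (\<integral>y. sqdist_gap k c y \<partial>\<mu>)"
    and opt: "\<And>c. \<forall>\<^sub>F N in sequentially. gap_objective (\<nu> N) \<alpha> k (a N) \<le> gap_objective (\<nu> N) \<alpha> k c"
    and s: "strict_mono (s :: nat \<Rightarrow> nat)"
  obtains r b where "strict_mono (r :: nat \<Rightarrow> nat)" "\<And>m. 1 \<le> s (r m)"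
    "\<And>i. i < k \<Longrightarrow> (\<lambda>m. a (s (r m)) i) \<longlonglongrightarrow> b i"
    "\<And>c. gap_objective \<mu> \<alpha> k b \<le> gap_objective \<mu> \<alpha> k c"
proof -
  define C where "C = 2 * (2 + 8 * real k / \<alpha>)"
  define X where "X = (\<integral>y. norm y \<partial>\<mu>) + 1"
  have C0: "0 \<le> C" using \<alpha> by (simp add: C_def)
  have "\<forall>\<^sub>F N in sequentially. dist (\<integral>y. norm y \<partial>\<nu> N) (\<integral>y. norm y \<partial>\<mu>) < 1"
    using norm_lim by (rule tendstoD) simp
  moreover have "\<forall>\<^sub>F N in sequentially. gap_objective (\<nu> N) \<alpha> k (a N) \<le> 0"
    using opt[of "\<lambda>_. 0"] by (simp add: gap_objective_zero[OF k])
  moreover have "\<forall>\<^sub>F N::nat in sequentially. 1 \<le> N" by (rule eventually_ge_at_top)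
  ultimately have "\<forall>\<^sub>F N in sequentially.
      1 \<le> N \<and> (\<integral>y. norm y \<partial>\<nu> N) \<le> X \<and> (\<forall>i<k. norm (a N i) \<le> C * X)"
  proof eventually_elim
    case (elim N)
    have le: "(\<integral>y. norm y \<partial>\<nu> N) \<le> X" using elim(1) by (simp add: X_def dist_real_def)
    moreover have "norm (a N i) \<le> C * X" if "i < k" for i
    proof -
      have "norm (a N i) \<le> C * (\<integral>y. norm y \<partial>\<nu> N)"
        unfolding C_def by (rule norm_le_of_gap_objective_nonpos[OF \<nu>[OF elim(3)] k \<alpha> elim(2) that])
      also have "\<dots> \<le> C * X" using le C0 by (rule mult_left_mono)
      finally show ?thesis .
    qed
    ultimately show ?case using elim(3) by blast
  qed
  then obtain n0 where n0: "\<And>N. n0 \<le> N \<Longrightarrow>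
      1 \<le> N \<and> (\<integral>y. norm y \<partial>\<nu> N) \<le> X \<and> (\<forall>i<k. norm (a N i) \<le> C * X)"
    by (auto simp: eventually_sequentially)
  \<comment> \<open>Since s is strictly increasing, m + n0 \<le> \<open>s (m + n0)\<close>; the
    shift makes the eventual bounds hold at every index.\<close>
  define t where "t m = s (m + n0)" for m
  have t_mono: "strict_mono t"
    using s unfolding t_def strict_mono_def by auto
  have t: "n0 \<le> t m" for m
    using seq_suble[OF s, of "m + n0"] by (simp add: t_def)
  obtain r b where r: "strict_mono (r :: nat \<Rightarrow> nat)"
    and b: "\<And>i. i < k \<Longrightarrow> (\<lambda>m. a (t (r m)) i) \<longlonglongrightarrow> b i" "\<And>i. i < k \<Longrightarrow> norm (b i) \<le> C * X"
    using bounded_tuples_convergent_subsequence[of k "\<lambda>m. a (t m)" "C * X"] n0 t by blast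
  define n where "n m = t (r m)" for m
  have n_mono: "strict_mono n"
    using strict_mono_o[OF t_mono r] by (simp add: n_def[abs_def] comp_def)
  have n: "1 \<le> n m" "(\<integral>y. norm y \<partial>\<nu> (n m)) \<le> X" "\<And>i. i < k \<Longrightarrow> norm (a (n m) i) \<le> C * X" for m
    using n0[OF t[of "r m"]] by (auto simp: n_def)
  define \<epsilon> where "\<epsilon> m = (\<Sum>i<k. norm (a (n m) i - b i))" for m
  have "\<epsilon> \<longlonglongrightarrow> (\<Sum>i<k. norm (b i - b i))"
    unfolding \<epsilon>_def[abs_def] n_def using b(1) by (intro tendsto_intros) auto
  then have \<epsilon>_lim: "\<epsilon> \<longlonglongrightarrow> 0" by simp
  have sub: "(\<lambda>m. \<integral>y. sqdist_gap k c y \<partial>\<nu> (n m)) \<longlonglongrightarrow> (\<integral>y. sqdist_gap k c y \<partial>\<mu>)" for c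
    using LIMSEQ_subseq_LIMSEQ[OF gap_lim n_mono] by (simp add: comp_def)
  \<comment> \<open>Tuple and measure vary together. The bound X on the first moments makes the
    Lipschitz constant uniform in m, so \<open>a (n m)\<close> may be replaced by b before the
    measures converge.\<close>
  have "(\<lambda>m. (\<integral>y. sqdist_gap k (a (n m)) y \<partial>\<nu> (n m)) - (\<integral>y. sqdist_gap k b y \<partial>\<nu> (n m))) \<longlonglongrightarrow> 0"
  proof (rule Lim_null_comparison)
    have "norm ((\<integral>y. sqdist_gap k (a (n m)) y \<partial>\<nu> (n m)) - (\<integral>y. sqdist_gap k b y \<partial>\<nu> (n m)))
        \<le> 2 * \<epsilon> m * (X + C * X)" for m
    proof -
      have "norm (a (n m) i - b i) \<le> \<epsilon> m" if "i < k" for i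
        unfolding \<epsilon>_def using that by (intro member_le_sum[where f = "\<lambda>i. norm (a (n m) i - b i)"]) auto
      then have "norm ((\<integral>y. sqdist_gap k (a (n m)) y \<partial>\<nu> (n m)) - (\<integral>y. sqdist_gap k b y \<partial>\<nu> (n m)))
        \<le> 2 * \<epsilon> m * ((\<integral>y. norm y \<partial>\<nu> (n m)) + C * X)"
        using gap_integral_lipschitz[OF \<nu>[OF n(1)] k _ n(3) b(2)] by simp
      also have "\<dots> \<le> 2 * \<epsilon> m * (X + C * X)"
        using n(2)[of m] by (intro mult_left_mono) (auto simp: \<epsilon>_def sum_nonneg)
      finally show ?thesis .
    qed
    then show "\<forall>\<^sub>F m in sequentially.
        norm ((\<integral>y. sqdist_gap k (a (n m)) y \<partial>\<nu> (n m)) - (\<integral>y. sqdist_gap k b y \<partial>\<nu> (n m)))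
        \<le> 2 * \<epsilon> m * (X + C * X)" by simp
    show "(\<lambda>m. 2 * \<epsilon> m * (X + C * X)) \<longlonglongrightarrow> 0"
      using tendsto_mult[OF tendsto_mult[OF tendsto_const[of 2] \<epsilon>_lim] tendsto_const[of "X + C * X"]] by simp
  qed
  from tendsto_add[OF this sub[of b]]
  have "(\<lambda>m. \<integral>y. sqdist_gap k (a (n m)) y \<partial>\<nu> (n m)) \<longlonglongrightarrow> (\<integral>y. sqdist_gap k b y \<partial>\<mu>)" by simp
  then have lhs: "(\<lambda>m. gap_objective (\<nu> (n m)) \<alpha> k (a (n m))) \<longlonglongrightarrow> gap_objective \<mu> \<alpha> k b"
    unfolding gap_objective_def using b(1)
    by (intro tendsto_intros tendsto_tuple_spread) (auto simp: n_def)
  have "gap_objective \<mu> \<alpha> k b \<le> gap_objective \<mu> \<alpha> k c" for c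
  proof (rule tendsto_le[OF _ _ lhs])
    show "(\<lambda>m. gap_objective (\<nu> (n m)) \<alpha> k c) \<longlonglongrightarrow> gap_objective \<mu> \<alpha> k c"
      unfolding gap_objective_def by (intro tendsto_intros sub)
    show "\<forall>\<^sub>F m in sequentially. gap_objective (\<nu> (n m)) \<alpha> k (a (n m)) \<le> gap_objective (\<nu> (n m)) \<alpha> k c"
      using eventually_compose_filterlim[OF opt filterlim_subseq[OF n_mono]] .
  qed simp
  \<comment> \<open>\<open>t (r m)\<close> is \<open>s (r m + n0)\<close>, so the shift is absorbed
    into the extracted indices.\<close>
  moreover have "strict_mono (\<lambda>m. r m + n0)" using r by (simp add: strict_mono_def)
  ultimately show ?thesis
    using that[of "\<lambda>m. r m + n0" b] n(1) b(1) by (simp add: n_def t_def)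
qed

subsection \<open>Empirical measures\<close>

text \<open>At N = 0 both sides are 0, so the equation rewrites a whole sequence of integrals, its
  initial term included.\<close>

lemma integral_empirical_measure:
  fixes f :: "'a::topological_space \<Rightarrow> real"
  assumes "f \<in> borel_measurable borel"
  shows "(\<integral>z. f z \<partial>empirical_measure N y) = (\<Sum>i=1..N. f (y i)) / real N"
proof -
  have "y \<in> measurable (uniform_count_measure {1..N}) borel"
    by (simp add: measurable_def sets_uniform_count_measure space_uniform_count_measure)
  then show ?thesis
    unfolding empirical_measure_def using assms
    by (simp add: integral_distr integral_uniform_count_measure)
qed

lemma second_moment_prob_empirical_measure:
  assumes "1 \<le> N"
  shows "second_moment_prob (empirical_measure N y)"
proof -
  have y: "y \<in> measurable (uniform_count_measure {1..N}) borel"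
    by (simp add: measurable_def sets_uniform_count_measure space_uniform_count_measure)
  interpret U: prob_space "uniform_count_measure {1..N}"
    using assms by (intro prob_space_uniform_count_measure) auto
  have "integrable (uniform_count_measure {1..N}) (\<lambda>i. (norm (y i))\<^sup>2)"
    unfolding uniform_count_measure_def by (intro integrable_point_measure_finite) auto
  then show ?thesis
    unfolding second_moment_prob_def empirical_measure_def
    using y U.prob_space_distr[OF y] by (simp add: integrable_distr_eq)
qed

text \<open>A point outside the support lies in a null open set, hence in a null member of a
  countable basis; countably many null sets have a null union.\<close>

lemma AE_in_measure_support:
  fixes \<mu> :: "'a::second_countable_topology measure"
  assumes "sets \<mu> = sets borel"
  shows "AE y in \<mu>. y \<in> measure_support \<mu>"
proof -
  obtain \<B> :: "'a set set" where \<B>: "countable \<B>" "topological_basis \<B>"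
    using ex_countable_basis by blast
  have "AE y in \<mu>. \<forall>B\<in>{B\<in>\<B>. emeasure \<mu> B = 0}. y \<notin> B"
  proof (subst AE_ball_countable)
    show "countable {B \<in> \<B>. emeasure \<mu> B = 0}" using \<B>(1) by simp
    show "\<forall>B\<in>{B \<in> \<B>. emeasure \<mu> B = 0}. AE y in \<mu>. y \<notin> B"
    proof
      fix B assume "B \<in> {B \<in> \<B>. emeasure \<mu> B = 0}"
      then have "B \<in> null_sets \<mu>"
        using topological_basis_open[OF \<B>(2)] assms by (auto simp: null_sets_def)
      then show "AE y in \<mu>. y \<notin> B" by (rule AE_not_in)
    qed
  qed
  then show ?thesis
  proof eventually_elim
    case (elim y)
    show ?case unfolding measure_support_def
    proof clarify
      fix U assume U: "open U" "y \<in> U"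
      obtain B where B: "B \<in> \<B>" "y \<in> B" "B \<subseteq> U" using topological_basisE[OF \<B>(2) U] .
      then have "0 < emeasure \<mu> B" using elim by (auto simp: zero_less_iff_neq_zero)
      also have "\<dots> \<le> emeasure \<mu> U"
        using B U assms by (intro emeasure_mono) auto
      finally show "0 < emeasure \<mu> U" .
    qed
  qed
qed

text \<open>If convergence fails, infinitely many terms stay at least e away from l. Enumerating
  them gives a subsequence without any further subsequence tending to l.\<close>

lemma LIMSEQ_of_subsequences:
  fixes f :: "nat \<Rightarrow> 'a::metric_space"
  assumes "\<And>s. strict_mono (s :: nat \<Rightarrow> nat) \<Longrightarrow> \<exists>r. strict_mono (r :: nat \<Rightarrow> nat) \<and> (\<lambda>m. f (s (r m))) \<longlonglongrightarrow> l"
  shows "f \<longlonglongrightarrow> l"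
proof (rule ccontr)
  assume "\<not> f \<longlonglongrightarrow> l"
  then obtain e where e: "0 < e" "\<forall>n. \<exists>m\<ge>n. \<not> dist (f m) l < e"
    unfolding lim_sequentially by auto
  then have "infinite {m. \<not> dist (f m) l < e}"
    unfolding infinite_nat_iff_unbounded_le by auto
  then obtain s where s: "strict_mono (s :: nat \<Rightarrow> nat)" "\<And>n. \<not> dist (f (s n)) l < e"
    using infinite_enumerate by blast
  obtain r :: "nat \<Rightarrow> nat" where "(\<lambda>m. f (s (r m))) \<longlonglongrightarrow> l" using assms[OF s(1)] by blast
  then have "\<forall>\<^sub>F m in sequentially. dist (f (s (r m))) l < e" using e(1) by (rule tendstoD)
  then have "\<forall>\<^sub>F m :: nat in sequentially. False" using s(2) by simp
  then show False by simp
qed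

lemma tuple_mset_in_solution_set_UNIV:
  assumes \<mu>: "second_moment_prob \<mu>" and k: "1 \<le> k"
    and opt: "\<And>c. gap_objective \<mu> \<alpha> k b \<le> gap_objective \<mu> \<alpha> k c"
  shows "tuple_mset k b \<in> solution_set \<mu> \<alpha> k UNIV"
proof -
  have "var_objective \<mu> \<alpha> (tuple_mset k b) \<le> var_objective \<mu> \<alpha> B" if B: "size B = k" for B
  proof -
    obtain c where "B = tuple_mset k c" using multiset_tuple_mset[OF B] .
    then show ?thesis using opt[of c] var_objective_le_iff[OF \<mu> k] by simp
  qed
  then show ?thesis by (auto simp: solution_set_def is_arg_min_def not_less)
qed

text \<open>The deterministic core: y is one sample path along which the averages converge and the
  hulls exhaust the space.\<close>

lemma solutions_subsequential_limit:
  fixes \<mu> :: "'a::euclidean_space measure" and y :: "nat \<Rightarrow> 'a" and A :: "nat \<Rightarrow> 'a multiset"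
  assumes k: "1 \<le> k" and \<alpha>: "0 < \<alpha>" and \<mu>: "second_moment_prob \<mu>"
    and dense: "\<And>U. open U \<Longrightarrow> U \<noteq> {} \<Longrightarrow> \<exists>c\<in>D. c \<in> U"
    and norm_lim: "(\<lambda>N. (\<Sum>i=1..N. norm (y i)) / real N) \<longlonglongrightarrow> (\<integral>z. norm z \<partial>\<mu>)"
    and gap_lim: "\<And>c. c \<in> D \<Longrightarrow>
      (\<lambda>N. (\<Sum>i=1..N. sqdist_gap k c (y i)) / real N) \<longlonglongrightarrow> (\<integral>z. sqdist_gap k c z \<partial>\<mu>)"
    and hull: "\<forall>r>0. \<exists>N\<ge>1. ball 0 r \<subseteq> convex hull (y ` {1..N})"
    and A: "\<And>N. 1 \<le> N \<Longrightarrow> A N \<in> solution_set (empirical_measure N y) \<alpha> k (convex hull (y ` {1..N}))"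
    and s: "strict_mono (s :: nat \<Rightarrow> nat)"
  shows "\<exists>r. strict_mono (r :: nat \<Rightarrow> nat) \<and> (\<forall>m. 1 \<le> s (r m)) \<and>
    (\<exists>A_lim\<in>solution_set \<mu> \<alpha> k UNIV. (\<lambda>m. dist_2_inf (A (s (r m))) A_lim) \<longlonglongrightarrow> 0)"
proof -
  note \<nu> = second_moment_prob_empirical_measure[of _ y]
  \<comment> \<open>The guard stays inside the quantifier so that choice yields a single sequence
    \<open>a\<close>, arbitrary at N = 0.\<close>
  have "\<forall>N. \<exists>b. 1 \<le> N \<longrightarrow> A N = tuple_mset k b"
  proof
    fix N
    have "\<exists>b. A N = tuple_mset k b" if "1 \<le> N"
    proof -
      have "size (A N) = k" using A[OF that] by (simp add: solution_set_def is_arg_min_def)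
      from multiset_tuple_mset[OF this] show ?thesis by metis
    qed
    then show "\<exists>b. 1 \<le> N \<longrightarrow> A N = tuple_mset k b" by blast
  qed
  then obtain a where a: "\<And>N. 1 \<le> N \<Longrightarrow> A N = tuple_mset k (a N)"
    unfolding choice_iff by blast
  have opt: "\<forall>\<^sub>F N in sequentially.
      gap_objective (empirical_measure N y) \<alpha> k (a N) \<le> gap_objective (empirical_measure N y) \<alpha> k c" for c
  proof -
    \<comment> \<open>The added 1 puts every \<open>c i\<close> strictly inside the open ball. Once
      that ball is covered it stays covered, as the sample hulls increase with N, so c is eventually
      feasible.\<close>
    define R where "R = (\<Sum>i<k. norm (c i)) + 1"
    have "0 < R" by (simp add: R_def add_nonneg_pos sum_nonneg)
    then obtain N0 where N0: "1 \<le> N0" "ball 0 R \<subseteq> convex hull (y ` {1..N0})" using hull by blast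
    have cR: "norm (c i) < R" if "i < k" for i
      unfolding R_def using member_le_sum[of i "{..<k}" "\<lambda>i. norm (c i)"] that by simp
    show ?thesis
      using eventually_ge_at_top[of N0]
    proof eventually_elim
      case (elim N)
      then have N: "1 \<le> N" using N0 by simp
      have "convex hull (y ` {1..N0}) \<subseteq> convex hull (y ` {1..N})"
        using elim by (intro hull_mono image_mono) auto
      then have "set_mset (tuple_mset k c) \<subseteq> convex hull (y ` {1..N})"
        using N0 cR by fastforce
      then have "var_objective (empirical_measure N y) \<alpha> (tuple_mset k (a N))
          \<le> var_objective (empirical_measure N y) \<alpha> (tuple_mset k c)"
        using A[OF N] a[OF N] by (auto simp: solution_set_def is_arg_min_def not_less)
      then show ?case using var_objective_le_iff[OF \<nu>[OF N] k] by simp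
    qed
  qed
  have nl: "(\<lambda>N. \<integral>z. norm z \<partial>empirical_measure N y) \<longlonglongrightarrow> (\<integral>z. norm z \<partial>\<mu>)"
    using norm_lim by (simp add: integral_empirical_measure)
  have gl: "(\<lambda>N. \<integral>z. sqdist_gap k c z \<partial>empirical_measure N y) \<longlonglongrightarrow> (\<integral>z. sqdist_gap k c z \<partial>\<mu>)" for c
    by (rule tendsto_gap_integral_of_dense[OF k \<mu> \<nu> dense nl])
      (use gap_lim in \<open>simp_all add: integral_empirical_measure\<close>)
  obtain r b where r: "strict_mono (r :: nat \<Rightarrow> nat)" "\<And>m. 1 \<le> s (r m)"
    and b: "\<And>i. i < k \<Longrightarrow> (\<lambda>m. a (s (r m)) i) \<longlonglongrightarrow> b i"
      "\<And>c. gap_objective \<mu> \<alpha> k b \<le> gap_objective \<mu> \<alpha> k c"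
    using minimizers_subsequential_limit[OF k \<alpha> \<mu> \<nu> nl gl opt s] by blast
  have "(\<lambda>m. dist_2_inf (A (s (r m))) (tuple_mset k b)) \<longlonglongrightarrow> 0"
    using tendsto_dist_2_inf_tuple_mset[OF k b(1)] a r(2) by simp
  then show ?thesis using r tuple_mset_in_solution_set_UNIV[OF \<mu> k b(2)] by blast
qed

section \<open>From sample paths to almost sure statements\<close>

theorem theorem1p12:
  fixes M :: "'w measure"
    and \<mu> :: "(real ^ 'd) measure"
    and x :: "nat \<Rightarrow> 'w \<Rightarrow> real ^ 'd"
    and A :: "nat \<Rightarrow> 'w \<Rightarrow> (real ^ 'd) multiset"
    and k :: nat and \<alpha> :: real
  assumes "1 \<le> k" and "\<alpha> > 0"
    and "prob_space \<mu>" and "sets \<mu> = sets borel"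
    and "integrable \<mu> (\<lambda>y. (norm y)\<^sup>2)"
    and "prob_space M"
    and "prob_space.indep_vars M (\<lambda>_. borel) x {1..}"
    and "\<And>i. 1 \<le> i \<Longrightarrow> distr M borel (x i) = \<mu>"
    and "\<And>N \<omega>. 1 \<le> N \<Longrightarrow> \<omega> \<in> space M \<Longrightarrow>
           A N \<omega> \<in> solution_set (empirical_measure N (\<lambda>i. x i \<omega>)) \<alpha> k
                     (convex hull ((\<lambda>i. x i \<omega>) ` {1..N}))"
    and "AE \<omega> in M. \<forall>r>0. \<exists>N\<ge>1. ball 0 r \<subseteq> convex hull ((\<lambda>i. x i \<omega>) ` {1..N})"
  shows "(AE \<omega> in M. \<exists>\<phi>. strict_mono \<phi> \<and> (\<forall>m. 1 \<le> \<phi> m) \<and>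
            (\<exists>A_lim \<in> solution_set \<mu> \<alpha> k (convex hull (measure_support \<mu>)).
               (\<lambda>m. dist_2_inf (A (\<phi> m) \<omega>) A_lim) \<longlonglongrightarrow> 0))
       \<and> (\<forall>A_star. solution_set \<mu> \<alpha> k (convex hull (measure_support \<mu>)) = {A_star} \<longrightarrow>
            (AE \<omega> in M. (\<lambda>N. dist_2_inf (A N \<omega>) A_star) \<longlonglongrightarrow> 0))"
proof -
  interpret M: prob_space M by fact
  have \<mu>: "second_moment_prob \<mu>" using assms by (simp add: second_moment_prob_def)
  have xm: "x i \<in> borel_measurable M" if "1 \<le> i" for i
    using assms(7) that by (auto simp: M.indep_vars_def)
  note hull = assms(10)
  \<comment> \<open>Each tuple c has its own exceptional null set in the strong law; countability of
    D lets them be merged into one.\<close>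
  obtain D :: "(nat \<Rightarrow> real ^ 'd) set" where D: "countable D"
    "\<And>U. open U \<Longrightarrow> U \<noteq> {} \<Longrightarrow> \<exists>c\<in>D. c \<in> U"
    by (rule countable_dense_setE) blast
  have norm_lim: "AE \<omega> in M. (\<lambda>N. (\<Sum>i=1..N. norm (x i \<omega>)) / real N) \<longlonglongrightarrow> (\<integral>z. norm z \<partial>\<mu>)"
    using assms(5) by (intro M.strong_law_iid[OF assms(7,8)]) auto
  have "AE \<omega> in M. (\<lambda>N. (\<Sum>i=1..N. sqdist_gap k c (x i \<omega>)) / real N) \<longlonglongrightarrow> (\<integral>z. sqdist_gap k c z \<partial>\<mu>)" for c
  proof (rule M.strong_law_iid[OF assms(7,8)])
    show "integrable \<mu> (\<lambda>z. (sqdist_gap k c z)\<^sup>2)" by (rule integrable_sqdist_gap_square[OF \<mu> assms(1)])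
  qed auto
  then have gap_lim: "AE \<omega> in M. \<forall>c\<in>D.
      (\<lambda>N. (\<Sum>i=1..N. sqdist_gap k c (x i \<omega>)) / real N) \<longlonglongrightarrow> (\<integral>z. sqdist_gap k c z \<partial>\<mu>)"
    using D(1) by (simp add: AE_ball_countable)
  have "AE \<omega> in M. x i \<omega> \<in> measure_support \<mu>" if "1 \<le> i" for i
  proof -
    have "AE y in distr M borel (x i). y \<in> measure_support \<mu>"
      unfolding assms(8)[OF that] by (rule AE_in_measure_support[OF assms(4)])
    then show ?thesis by (rule AE_distrD[OF xm[OF that]])
  qed
  then have "AE \<omega> in M. \<forall>i\<in>{1..}. x i \<omega> \<in> measure_support \<mu>"
    by (subst AE_ball_countable) auto
  \<comment> \<open>Almost surely all samples lie in the support, so the sample hulls that exhaust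
    the space are contained in the hull of the support.\<close>
  with hull have "AE \<omega> in M. convex hull (measure_support \<mu>) = UNIV"
  proof eventually_elim
    case (elim \<omega>)
    have "z \<in> convex hull (measure_support \<mu>)" for z
    proof -
      have "0 < norm z + 1" by (simp add: add_nonneg_pos)
      then obtain N where "ball 0 (norm z + 1) \<subseteq> convex hull ((\<lambda>i. x i \<omega>) ` {1..N})"
        using elim(1) by blast
      moreover have "convex hull ((\<lambda>i. x i \<omega>) ` {1..N}) \<subseteq> convex hull (measure_support \<mu>)"
        using elim(2) by (intro hull_mono) auto
      moreover have "z \<in> ball 0 (norm z + 1)" by simp
      ultimately show ?thesis by blast
    qed
    then show ?case by blast
  qed
  \<comment> \<open>The assertion does not involve \<omega>, and on a probability space an almost
    sure constant assertion is true.\<close>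
  then have supp: "convex hull (measure_support \<mu>) = UNIV" by simp
  \<comment> \<open>All subsequences s are treated outside one null set; there are uncountably many,
    so the quantifier has to stand inside.\<close>
  have key: "AE \<omega> in M. \<forall>s. strict_mono (s :: nat \<Rightarrow> nat) \<longrightarrow>
    (\<exists>r. strict_mono (r :: nat \<Rightarrow> nat) \<and> (\<forall>m. 1 \<le> s (r m)) \<and>
      (\<exists>A_lim\<in>solution_set \<mu> \<alpha> k UNIV. (\<lambda>m. dist_2_inf (A (s (r m)) \<omega>) A_lim) \<longlonglongrightarrow> 0))"
    using norm_lim gap_lim hull AE_space
  proof eventually_elim
    case (elim \<omega>)
    show ?case
      using elim(2) by (intro allI impI
        solutions_subsequential_limit[OF assms(1,2) \<mu> D(2) elim(1) _ elim(3) assms(9)[OF _ elim(4)]]) auto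
  qed
  show ?thesis
  proof (intro conjI allI impI)
    show "AE \<omega> in M. \<exists>\<phi>. strict_mono \<phi> \<and> (\<forall>m. 1 \<le> \<phi> m) \<and>
            (\<exists>A_lim \<in> solution_set \<mu> \<alpha> k (convex hull (measure_support \<mu>)).
               (\<lambda>m. dist_2_inf (A (\<phi> m) \<omega>) A_lim) \<longlonglongrightarrow> 0)"
      using key
    proof eventually_elim
      case (elim \<omega>)
      have "strict_mono (\<lambda>n::nat. n)" by (simp add: strict_mono_def)
      with elim show ?case unfolding supp by blast
    qed
    fix A_star assume "solution_set \<mu> \<alpha> k (convex hull (measure_support \<mu>)) = {A_star}"
    then have star: "solution_set \<mu> \<alpha> k UNIV = {A_star}" by (simp add: supp)
    show "AE \<omega> in M. (\<lambda>N. dist_2_inf (A N \<omega>) A_star) \<longlonglongrightarrow> 0"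
      using key
    proof eventually_elim
      case (elim \<omega>)
      \<comment> \<open>By uniqueness every extracted subsequence has the same limit
        \<open>A_star\<close>, so the distances tend to 0 along the full sequence.\<close>
      then show ?case unfolding star by (intro LIMSEQ_of_subsequences) blast
    qed
  qed
qed

end
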